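(* Let $\mathcal T=\begin{pmatrix}A&B\\ B^*&D\end{pmatrix}$ be the selfadjoint block operator matrix described in the context, with $d=\max\sigma(D)<a=\min\sigma(A)$, forms $\mathfrak s(\lambda)$ and $\lambda_{e+}=\inf(\sigma_{\mathrm{ess}}(\mathcal T)\cap(d,\infty))$. Assume that there exist $x_0\in\mathcal D(B^* )\setminus\{0\}$ and $\lambda\in[a,\lambda_{e+})$ such that $\mathfrak s(\lambda)[x_0]\le0$. Then $\mathcal T$ has at least one eigenvalue in the interval $[a,\lambda]$.
   Context: Let $\mathcal H$ be a Hilbert space, $B$ a densely defined closed linear operator in $\mathcal H$, and $A,D$ bounded selfadjoint operators on $\mathcal H$. The operator $$\mathcal T=\begin{pmatrix}A&B\\ B^*&D\end{pmatrix},\qquad \mathcal D(\mathcal T)=\mathcal D(B^* )\oplus\mathcal D(B)\subseteq\mathcal H\oplus\mathcal H,$$ is selfadjoint. Set $d=\max\sigma(D)$, $a=\min\sigma(A)$ and assume $d<a$. For $\operatorname{Re}\lambda>d$ define the sesquilinear form $$\mathfrak s(\lambda)[x,y]=\langle(A-\lambda)x,y\rangle-\langle(D-\lambda)^{-1}B^*x,B^*y\rangle,\qquad \mathcal D(\mathfrak s(\lambda))=\mathcal D(B^* ),$$ and write $\mathfrak s(\lambda)[x]=\mathfrak s(\lambda)[x,x]$. The essential spectrum $\sigma_{\mathrm{ess}}(\mathcal T)$ is the set of $\lambda\in\mathbb{C}$ for which $\mathcal T-\lambda$ is not Fredholm, and $\lambda_{e+}=\inf(\sigma_{\mathrm{ess}}(\mathcal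 T)\cap(d,\infty))$ (with $\inf\emptyset=+\infty$). *)

theory Defs
  imports "HOL-Analysis.Analysis"
begin

section \<open>Complex Hilbert spaces\<close>

text \<open>
  A complex Hilbert space is a complete real inner product space with a compatible complex scalar
  multiplication and a complex inner product, linear in its first argument, whose real part is the
  given real inner product.  Definiteness, the norm and completeness are thus those of the
  underlying real space; in particular \<open>cinner x x = (norm x)\<^sup>2\<close>.
\<close>

class complex_hilbert_space = real_inner + complete_space +
  fixes scaleC :: "complex \<Rightarrow> 'a \<Rightarrow> 'a"  (infixr \<open>*\<^sub>C\<close> 75)
    and cinner :: "'a \<Rightarrow> 'a \<Rightarrow> complex"
  assumes scaleC_add_right: "c *\<^sub>C (x + y) = c *\<^sub>C x + c *\<^sub>C y"
    and scaleC_add_left: "(b + c) *\<^sub>C x = b *\<^sub>C x + c *\<^sub>C x"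
    and scaleC_scaleC: "b *\<^sub>C (c *\<^sub>C x) = (b * c) *\<^sub>C x"
    and scaleR_scaleC: "r *\<^sub>R x = complex_of_real r *\<^sub>C x"
    and cinner_add_left: "cinner (x + y) z = cinner x z + cinner y z"
    and cinner_scaleC_left: "cinner (c *\<^sub>C x) y = c * cinner x y"
    and cinner_commute: "cinner x y = cnj (cinner y x)"
    and inner_eq_Re_cinner: "inner x y = Re (cinner x y)"

global_interpretation complex_vector: vector_space "scaleC :: complex \<Rightarrow> 'a \<Rightarrow> 'a::complex_hilbert_space"
  defines csubspace = complex_vector.subspace
    and cspan = complex_vector.span
proof
  fix x :: 'a
  show "1 *\<^sub>C x = x"
    using scaleR_scaleC[of 1 x] by simp
qed (simp_all add: scaleC_add_right scaleC_add_left scaleC_scaleC)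

text \<open>The orthogonal sum of two Hilbert spaces; norm and topology are the library's on products.\<close>

instantiation prod :: (complex_hilbert_space, complex_hilbert_space) complex_hilbert_space
begin

definition scaleC_prod :: "complex \<Rightarrow> 'a \<times> 'b \<Rightarrow> 'a \<times> 'b" where
  "scaleC_prod c p = (c *\<^sub>C fst p, c *\<^sub>C snd p)"

definition cinner_prod :: "'a \<times> 'b \<Rightarrow> 'a \<times> 'b \<Rightarrow> complex" where
  "cinner_prod p q = cinner (fst p) (fst q) + cinner (snd p) (snd q)"

instance
proof
  fix x y :: "'a \<times> 'b"
  show "cinner x y = cnj (cinner y x)"
    unfolding cinner_prod_def complex_cnj_add
    using cinner_commute[of "fst x" "fst y"] cinner_commute[of "snd x" "snd y"] by simp
qed (auto simp: scaleC_prod_def cinner_prod_def scaleC_add_right scaleC_add_left scaleC_scaleC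
      scaleR_scaleC cinner_add_left cinner_scaleC_left inner_prod_def inner_eq_Re_cinner
      algebra_simps prod_eq_iff)

end

section \<open>Unbounded operators\<close>

text \<open>An operator is a domain with a map; the values of the map off the domain are irrelevant.\<close>

datatype ('a, 'b) operator = Operator (op_dom: "'a set") (op_app: "'a \<Rightarrow> 'b")

definition linear_operator ::
    "('a::complex_hilbert_space, 'b::complex_hilbert_space) operator \<Rightarrow> bool" where
  "linear_operator T \<longleftrightarrow> csubspace (op_dom T) \<and>
     (\<forall>x\<in>op_dom T. \<forall>y\<in>op_dom T. op_app T (x + y) = op_app T x + op_app T y) \<and>
     (\<forall>c. \<forall>x\<in>op_dom T. op_app T (c *\<^sub>C x) = c *\<^sub>C op_app T x)"

definition densely_defined :: "('a::complex_hilbert_space, 'b) operator \<Rightarrow> bool" where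
  "densely_defined T \<longleftrightarrow> closure (op_dom T) = UNIV"

definition closed_operator ::
    "('a::complex_hilbert_space, 'b::complex_hilbert_space) operator \<Rightarrow> bool" where
  "closed_operator T \<longleftrightarrow> closed {(x, op_app T x) | x. x \<in> op_dom T}"

text \<open>Meaningful for densely defined operators, where the adjoint vector is unique.\<close>

definition op_adjoint ::
    "('a::complex_hilbert_space, 'b::complex_hilbert_space) operator \<Rightarrow> ('b, 'a) operator" where
  "op_adjoint T = Operator
     {y. \<exists>z. \<forall>x\<in>op_dom T. cinner (op_app T x) y = cinner x z}
     (\<lambda>y. THE z. \<forall>x\<in>op_dom T. cinner (op_app T x) y = cinner x z)"

definition everywhere :: "('a \<Rightarrow> 'b) \<Rightarrow> ('a, 'b) operator" where
  "everywhere A = Operator UNIV A"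

definition bounded_selfadjoint :: "('a::complex_hilbert_space \<Rightarrow> 'a) \<Rightarrow> bool" where
  "bounded_selfadjoint A \<longleftrightarrow> bounded_linear A \<and> (\<forall>c x. A (c *\<^sub>C x) = c *\<^sub>C A x) \<and>
     (\<forall>x y. cinner (A x) y = cinner x (A y))"

section \<open>Spectra\<close>

definition op_shift ::
    "('a::complex_hilbert_space, 'a) operator \<Rightarrow> complex \<Rightarrow> ('a, 'a) operator" where
  "op_shift T \<mu> = Operator (op_dom T) (\<lambda>x. op_app T x - \<mu> *\<^sub>C x)"

definition resolvent ::
    "('a::complex_hilbert_space, 'a) operator \<Rightarrow> complex \<Rightarrow> 'a \<Rightarrow> 'a" where
  "resolvent T \<mu> = inv_into (op_dom T) (op_app (op_shift T \<mu>))"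

definition resolvent_set :: "('a::complex_hilbert_space, 'a) operator \<Rightarrow> complex set" where
  "resolvent_set T = {\<mu>. bij_betw (op_app (op_shift T \<mu>)) (op_dom T) UNIV \<and>
                         bounded_linear (resolvent T \<mu>)}"

definition spectrum :: "('a::complex_hilbert_space, 'a) operator \<Rightarrow> complex set" where
  "spectrum T = - resolvent_set T"

definition eigenvalue :: "('a::complex_hilbert_space, 'a) operator \<Rightarrow> complex \<Rightarrow> bool" where
  "eigenvalue T \<mu> \<longleftrightarrow> (\<exists>x\<in>op_dom T. x \<noteq> 0 \<and> op_app T x = \<mu> *\<^sub>C x)"

definition op_kernel :: "('a, 'b::zero) operator \<Rightarrow> 'a set" where
  "op_kernel T = {x \<in> op_dom T. op_app T x = 0}"

definition op_range :: "('a, 'b) operator \<Rightarrow> 'b set" where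
  "op_range T = op_app T ` op_dom T"

definition finite_cdim :: "'a::complex_hilbert_space set \<Rightarrow> bool" where
  "finite_cdim V \<longleftrightarrow> (\<exists>S. finite S \<and> V \<subseteq> cspan S)"

definition finite_ccodim :: "'a::complex_hilbert_space set \<Rightarrow> bool" where
  "finite_ccodim V \<longleftrightarrow> (\<exists>S. finite S \<and> {v + s | v s. v \<in> V \<and> s \<in> cspan S} = UNIV)"

definition fredholm ::
    "('a::complex_hilbert_space, 'b::complex_hilbert_space) operator \<Rightarrow> bool" where
  "fredholm T \<longleftrightarrow> closed_operator T \<and> closed (op_range T) \<and>
     finite_cdim (op_kernel T) \<and> finite_ccodim (op_range T)"

definition ess_spectrum :: "('a::complex_hilbert_space, 'a) operator \<Rightarrow> complex set" where
  "ess_spectrum T = {\<mu>. \<not> fredholm (op_shift T \<mu>)}"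

text \<open>
  The spectrum of a selfadjoint operator is real, so its maximum and minimum are taken over the
  real numbers it contains.
\<close>

definition is_max_spectrum :: "('a::complex_hilbert_space, 'a) operator \<Rightarrow> real \<Rightarrow> bool" where
  "is_max_spectrum T m \<longleftrightarrow> complex_of_real m \<in> spectrum T \<and>
     (\<forall>t::real. complex_of_real t \<in> spectrum T \<longrightarrow> t \<le> m)"

definition is_min_spectrum :: "('a::complex_hilbert_space, 'a) operator \<Rightarrow> real \<Rightarrow> bool" where
  "is_min_spectrum T m \<longleftrightarrow> complex_of_real m \<in> spectrum T \<and>
     (\<forall>t::real. complex_of_real t \<in> spectrum T \<longrightarrow> m \<le> t)"

section \<open>The block operator matrix\<close>

definition block_operator ::
    "('a::complex_hilbert_space \<Rightarrow> 'a) \<Rightarrow> ('a, 'a) operator \<Rightarrow> ('a \<Rightarrow> 'a) \<Rightarrow>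
     ('a \<times> 'a, 'a \<times> 'a) operator" where
  "block_operator A B D = Operator (op_dom (op_adjoint B) \<times> op_dom B)
     (\<lambda>(x, y). (A x + op_app B y, op_app (op_adjoint B) x + D y))"

text \<open>
  The form has domain \<open>op_dom (op_adjoint B)\<close> and is considered for \<open>Re \<lambda> > max \<sigma>(D)\<close>, where
  \<open>D - \<lambda>\<close> is boundedly invertible.  For real \<open>\<lambda>\<close> it is symmetric, so its quadratic form is
  real valued and a sign condition on it is a condition on its real part.
\<close>

definition schur_form ::
    "('a::complex_hilbert_space \<Rightarrow> 'a) \<Rightarrow> ('a, 'a) operator \<Rightarrow> ('a \<Rightarrow> 'a) \<Rightarrow> complex \<Rightarrow>
     'a \<Rightarrow> 'a \<Rightarrow> complex" where
  "schur_form A B D \<mu> x y = cinner (A x - \<mu> *\<^sub>C x) y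
     - cinner (resolvent (everywhere D) \<mu> (op_app (op_adjoint B) x)) (op_app (op_adjoint B) y)"

text \<open>Extended real valued: the infimum of the empty set is \<open>\<infinity>\<close>.\<close>

definition lambda_e_plus :: "('a::complex_hilbert_space, 'a) operator \<Rightarrow> real \<Rightarrow> ereal" where
  "lambda_e_plus T d = Inf (ereal ` {t. d < t \<and> complex_of_real t \<in> ess_spectrum T})"

end

theory Submission
  imports Defs
begin

text \<open>
  Suppose \<open>T\<close> has no eigenvalue in \<open>[a, \<nu>]\<close>.  For \<open>\<kappa>\<close> in this interval \<open>T - \<kappa>\<close> is then selfadjoint,
  Fredholm and injective, hence boundedly invertible.  The first component \<open>x\<close> of
  \<open>(T - \<kappa>)\<^sup>-\<^sup>1 (z, 0)\<close> represents the functional \<open>inner z\<close> in the form \<open>s \<kappa>\<close>, so wherever \<open>s \<kappa>\<close> is nonnegative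
  it is in fact bounded below by a positive multiple of the norm squared.  Since \<open>s a \<ge> 0\<close> and
  \<open>s\<close> depends continuously on \<open>\<kappa>\<close>, in the form sense, nonnegativity propagates from \<open>a\<close> to
  \<open>\<nu>\<close>, and \<open>s \<nu>\<close> is strictly positive, contradicting the choice of \<open>x0\<close>.  As \<open>\<kappa>\<close> is real, only the
  real inner product is needed.
\<close>

section \<open>Orthogonal complements and symmetric maps\<close>

text \<open>A minimizing sequence is Cauchy by the parallelogram identity, since midpoints stay in
  the convex set; completeness and closedness then supply the minimizer.\<close>

lemma exists_nearest_point:
  fixes S :: "'a::{real_inner,complete_space} set"
  assumes "closed S" and "convex S" and "S \<noteq> {}"
  shows "\<exists>p\<in>S. \<forall>z\<in>S. dist x p \<le> dist x z"
proof -
  define \<delta> where "\<delta> = infdist x S"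
  have \<delta>: "0 \<le> \<delta>" "\<And>z. z \<in> S \<Longrightarrow> \<delta> \<le> dist x z"
    unfolding \<delta>_def by (auto simp: infdist_nonneg infdist_le)
  \<comment> \<open>The slack sits on the squared distance because the parallelogram identity is
    linear in squares.\<close>
  have "\<exists>u\<in>S. (dist x u)\<^sup>2 < \<delta>\<^sup>2 + 1 / real (Suc n)" for n
  proof (rule ccontr)
    assume "\<not> ?thesis"
    then have "sqrt (\<delta>\<^sup>2 + 1 / real (Suc n)) \<le> dist x u" if "u \<in> S" for u
      using that by (intro real_le_lsqrt) (auto simp: not_less)
    then have "sqrt (\<delta>\<^sup>2 + 1 / real (Suc n)) \<le> \<delta>"
      unfolding \<delta>_def infdist_notempty[OF \<open>S \<noteq> {}\<close>] using \<open>S \<noteq> {}\<close> by (intro cINF_greatest) auto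
    moreover have "\<delta> < sqrt (\<delta>\<^sup>2 + 1 / real (Suc n))"
      using \<delta>(1) by (intro real_less_rsqrt) auto
    ultimately show False by simp
  qed
  then obtain u where u: "\<And>n. u n \<in> S" "\<And>n. (dist x (u n))\<^sup>2 < \<delta>\<^sup>2 + 1 / real (Suc n)"
    by metis
  have diff: "(dist (u m) (u n))\<^sup>2 \<le> 2 / real (Suc m) + 2 / real (Suc n)" for m n
  proof -
    define w where "w = (1/2) *\<^sub>R u m + (1/2) *\<^sub>R u n"
    have "w \<in> S"
      unfolding w_def using \<open>convex S\<close> u(1) by (intro convexD) auto
    then have "\<delta>\<^sup>2 \<le> (dist x w)\<^sup>2"
      using \<delta> by (simp add: power_mono)
    moreover have "(dist (u m) (u n))\<^sup>2 = 2 * (dist x (u m))\<^sup>2 + 2 * (dist x (u n))\<^sup>2 - 4 * (dist x w)\<^sup>2"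
      unfolding dist_norm w_def power2_norm_eq_inner
      by (simp add: inner_commute algebra_simps)
    ultimately show ?thesis
      using u(2)[of m] u(2)[of n] by linarith
  qed
  have "Cauchy u"
  proof (rule metric_CauchyI)
    fix e :: real assume "0 < e"
    then obtain N where N: "4 / e\<^sup>2 < real N"
      using reals_Archimedean2 by blast
    have "dist (u m) (u n) < e" if "N \<le> m" "N \<le> n" for m n
    proof -
      have pos: "0 < real N" using N \<open>0 < e\<close> by (smt (verit) divide_nonneg_nonneg zero_le_power2)
      have "2 / real (Suc m) \<le> 2 / real N" "2 / real (Suc n) \<le> 2 / real N"
        using that pos by (auto intro!: divide_left_mono)
      then have "(dist (u m) (u n))\<^sup>2 \<le> 4 / real N"
        using diff[of m n] by simp
      also have "\<dots> < e\<^sup>2"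
        using N \<open>0 < e\<close> pos by (simp add: field_simps)
      finally show ?thesis
        using \<open>0 < e\<close> by (simp add: power_less_imp_less_base)
    qed
    then show "\<exists>N. \<forall>m\<ge>N. \<forall>n\<ge>N. dist (u m) (u n) < e" by blast
  qed
  then obtain p where p: "u \<longlonglongrightarrow> p"
    by (auto simp: Cauchy_convergent_iff convergent_def)
  have "p \<in> S"
    using \<open>closed S\<close> p u(1) closed_sequentially by blast
  have "(\<lambda>n. (dist x (u n))\<^sup>2) \<longlonglongrightarrow> (dist x p)\<^sup>2"
    using p by (intro tendsto_intros)
  moreover have "(\<lambda>n. \<delta>\<^sup>2 + 1 / real (Suc n)) \<longlonglongrightarrow> \<delta>\<^sup>2 + 0"
    using LIMSEQ_inverse_real_of_nat by (intro tendsto_intros) (simp add: inverse_eq_divide)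
  ultimately have "(dist x p)\<^sup>2 \<le> \<delta>\<^sup>2 + 0"
    by (rule LIMSEQ_le) (intro exI[of _ 0] allI impI less_imp_le[OF u(2)])
  then have "dist x p \<le> \<delta>"
    using power2_le_imp_le[OF _ \<delta>(1)] by simp
  then show ?thesis
    using \<open>p \<in> S\<close> \<delta>(2) by (meson order_trans)
qed

text \<open>With \<open>p\<close> the point of \<open>M\<close> nearest to \<open>x\<close>, the
  vector \<open>x - p\<close> is orthogonal to \<open>M\<close>; the hypothesis makes it orthogonal
  to \<open>x\<close> too, hence to itself.\<close>

lemma in_closed_subspaceI:
  fixes M :: "'a::{real_inner,complete_space} set"
  assumes "closed M" and "subspace M"
    and orth: "\<And>p. (\<And>m. m \<in> M \<Longrightarrow> inner p m = 0) \<Longrightarrow> inner p x = 0"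
  shows "x \<in> M"
proof -
  have cM: "convex M" and neM: "M \<noteq> {}"
    using \<open>subspace M\<close> subspace_0 by (auto simp: subspace_imp_convex)
  obtain p where p: "p \<in> M" "\<forall>z\<in>M. dist x p \<le> dist x z"
    using exists_nearest_point[OF \<open>closed M\<close> cM neM] by blast
  have le: "inner (x - p) m \<le> 0" if "m \<in> M" for m
    using any_closest_point_dot[OF cM \<open>closed M\<close> p(1) _ p(2), of "p + m"] that p(1)
      subspace_add[OF \<open>subspace M\<close>] by simp
  have zero: "inner (x - p) m = 0" if "m \<in> M" for m
    using le[OF that] le[OF subspace_neg[OF \<open>subspace M\<close> that]] by simp
  have "inner (x - p) (x - p) = 0"
    using orth[OF zero] zero[OF p(1)] by (simp add: inner_diff_right)
  then show ?thesis
    using p(1) by simp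
qed

lemma dense_inner_eqI:
  fixes u v :: "'a::real_inner"
  assumes "closure S = UNIV" and "\<And>x. x \<in> S \<Longrightarrow> inner x u = inner x v"
  shows "u = v"
proof -
  have "closed {x. inner x u = inner x v}"
    by (intro closed_Collect_eq continuous_intros)
  then have "closure S \<subseteq> {x. inner x u = inner x v}"
    using assms(2) by (intro closure_minimal) auto
  then have "inner (u - v) u = inner (u - v) v"
    using assms(1) by auto
  then show ?thesis
    by (metis eq_iff_diff_eq_0 inner_diff_right inner_eq_zero_iff)
qed

text \<open>The Hellinger--Toeplitz theorem: by symmetry the sets \<open>{f. norm (R f) \<le> n}\<close> are closed, so
  Baire's theorem applies to them.\<close>

lemma symmetric_imp_bounded:
  fixes R :: "'a::{real_inner,complete_space} \<Rightarrow> 'a"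
  assumes sym: "\<And>x y. inner (R x) y = inner x (R y)"
  obtains K where "0 < K" and "\<And>x. norm (R x) \<le> K * norm x"
proof -
  \<comment> \<open>Linearity of \<open>R\<close> comes from symmetry: move \<open>R\<close> to the
    other argument and use linearity of the inner product.\<close>
  have diff: "R (x - y) = R x - R y" for x y
    by (rule dense_inner_eqI[of UNIV]) (simp_all add: sym[symmetric] inner_diff_right)
  have scale: "R (c *\<^sub>R x) = c *\<^sub>R R x" for c x
    by (rule dense_inner_eqI[of UNIV]) (simp_all add: sym[symmetric])
  define E where "E n = {f. norm (R f) \<le> real n}" for n
  \<comment> \<open>The norm is tested against the unit ball and \<open>R\<close> moved onto the
    test vector, so \<open>E n\<close> is an intersection of closed half-spaces.\<close>
  have "E n = (\<Inter>g\<in>{g. norm g \<le> 1}. {f. inner f (R g) \<le> real n})" for n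
  proof (intro equalityI subsetI)
    fix f assume "f \<in> E n"
    then have "inner (R f) g \<le> real n" if "norm g \<le> 1" for g
      using that norm_cauchy_schwarz[of "R f" g] mult_left_le[of "norm g" "norm (R f)"]
      by (simp add: E_def)
    then show "f \<in> (\<Inter>g\<in>{g. norm g \<le> 1}. {f. inner f (R g) \<le> real n})"
      by (simp add: sym)
  next
    fix f assume f: "f \<in> (\<Inter>g\<in>{g. norm g \<le> 1}. {f. inner f (R g) \<le> real n})"
    \<comment> \<open>This test vector attains the norm of \<open>R f\<close>, also when
      \<open>R f = 0\<close>, as \<open>sgn 0 = 0\<close>.\<close>
    have "norm (sgn (R f)) \<le> 1" by (simp add: norm_sgn)
    then have "inner (R f) (sgn (R f)) \<le> real n"
      using f by (simp add: sym)
    moreover have "inner (R f) (sgn (R f)) = norm (R f)"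
      by (simp add: sgn_div_norm power2_norm_eq_inner[symmetric] power2_eq_square field_simps)
    ultimately show "f \<in> E n" by (simp add: E_def)
  qed
  then have closed: "closed (E n)" for n
    by (auto intro!: closed_INT closed_Collect_le continuous_intros)
  have "\<exists>n. interior (E n) \<noteq> {}"
  proof (rule ccontr)
    assume "\<nexists>n. interior (E n) \<noteq> {}"
    then have "euclidean interior_of \<Union> (range E) = {}"
      using closed completely_metrizable_space_euclidean
      by (intro Baire_category_alt) auto
    moreover have "\<Union> (range E) = UNIV"
      by (auto simp: E_def real_arch_simple)
    ultimately show False by simp
  qed
  then obtain n f where "f \<in> interior (E n)" by blast
  then obtain r where r: "0 < r" "cball f r \<subseteq> E n"
    by (metis mem_interior_cball)
  \<comment> \<open>A vector \<open>h\<close> of norm \<open>r\<close> satisfies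
    \<open>R h = R (f + h) - R f\<close>, which has norm at most \<open>2 * n\<close>; the added 1
    keeps the constant positive for \<open>n = 0\<close>.\<close>
  have "norm (R x) \<le> (2 * real n + 1) / r * norm x" for x
  proof (cases "x = 0")
    case True
    then show ?thesis using diff[of 0 0] by simp
  next
    case False
    define h where "h = (r / norm x) *\<^sub>R x"
    have "f + h \<in> E n" "f \<in> E n"
      using r False by (auto simp: h_def dist_norm subset_eq)
    then have "norm (R h) \<le> 2 * real n + 1"
      using diff[of "f + h" f] norm_triangle_ineq4[of "R (f + h)" "R f"] by (simp add: E_def)
    then show ?thesis
      using False \<open>0 < r\<close> by (simp add: h_def scale field_simps)
  qed
  then show thesis
    using r(1) by (intro that[of "(2 * real n + 1) / r"]) auto
qed

section \<open>Coercive forms and numerical ranges\<close>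

text \<open>Expand \<open>0 \<le> s (z - t *\<^sub>R x) (z - t *\<^sub>R x)\<close> at \<open>t = 1 / K\<close>, where \<open>x\<close> represents \<open>inner z\<close>.\<close>

lemma nonneg_form_coercive:
  fixes s :: "'a::real_inner \<Rightarrow> 'a \<Rightarrow> real"
  assumes "0 < K"
    and expand: "\<And>x z t. x \<in> V \<Longrightarrow> z \<in> V \<Longrightarrow>
      s (z - t *\<^sub>R x) (z - t *\<^sub>R x) = s z z - 2 * t * s x z + t\<^sup>2 * s x x"
    and nonneg: "\<And>x z t. x \<in> V \<Longrightarrow> z \<in> V \<Longrightarrow> 0 \<le> s (z - t *\<^sub>R x) (z - t *\<^sub>R x)"
    and represent: "\<And>z. \<exists>x\<in>V. norm x \<le> K * norm z \<and> (\<forall>w\<in>V. s x w = inner z w)"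
    and "z \<in> V"
  shows "(norm z)\<^sup>2 / K \<le> s z z"
proof -
  obtain x where x: "x \<in> V" "norm x \<le> K * norm z" "\<And>w. w \<in> V \<Longrightarrow> s x w = inner z w"
    using represent by blast
  have "s x x \<le> norm z * norm x"
    using x norm_cauchy_schwarz by metis
  also have "\<dots> \<le> norm z * (K * norm z)"
    using x(2) by (intro mult_left_mono) auto
  finally have sxx: "s x x \<le> K * (norm z)\<^sup>2"
    by (simp add: power2_eq_square ac_simps)
  have "0 \<le> s z z - 2 * (1 / K) * s x z + (1 / K)\<^sup>2 * s x x"
    using nonneg[OF x(1) \<open>z \<in> V\<close>, of "1 / K"] expand[OF x(1) \<open>z \<in> V\<close>, of "1 / K"] by simp
  also have "s x z = (norm z)\<^sup>2"
    using x(3)[OF \<open>z \<in> V\<close>] by (simp add: power2_norm_eq_inner)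
  also have "(1 / K)\<^sup>2 * s x x \<le> (1 / K)\<^sup>2 * (K * (norm z)\<^sup>2)"
    using sxx by (intro mult_left_mono) auto
  also have "\<dots> = (norm z)\<^sup>2 / K"
    using \<open>0 < K\<close> by (simp add: power2_eq_square)
  finally show ?thesis by (simp add: field_simps)
qed

text \<open>The infimum of the numerical range of a bounded symmetric map is never a regular point.\<close>

lemma numerical_range_lower_bound:
  fixes Q :: "'a::real_inner \<Rightarrow> 'a"
  assumes lin: "bounded_linear Q" and sym: "\<And>x y. inner (Q x) y = inner x (Q y)"
    and reg: "\<And>t. t < l \<Longrightarrow> \<exists>R. bounded_linear R \<and> (\<forall>z. Q (R z) - t *\<^sub>R R z = z)"
  shows "l * (norm x)\<^sup>2 \<le> inner (Q x) x"
proof -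
  interpret Q: bounded_linear Q by (rule lin)
  define N where "N = (\<lambda>x. inner (Q x) x) ` {x. norm x = 1}"
  obtain C where C: "\<And>x. norm (Q x) \<le> norm x * C"
    using Q.bounded by blast
  have bdd: "bdd_below N"
  proof (rule bdd_belowI)
    fix r assume "r \<in> N"
    then obtain x where x: "norm x = 1" "r = inner (Q x) x" by (auto simp: N_def)
    then show "- C \<le> r"
      using C[of x] Cauchy_Schwarz_ineq2[of "Q x" x] by simp
  qed
  have Inf_le: "Inf N * (norm x)\<^sup>2 \<le> inner (Q x) x" for x
  proof (cases "x = 0")
    case False
    then have "Inf N \<le> inner (Q (sgn x)) (sgn x)"
      using bdd by (intro cInf_lower) (auto simp: N_def norm_sgn)
    then show ?thesis
      using False by (simp add: sgn_div_norm Q.scale field_simps power2_eq_square)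
  qed simp
  show ?thesis
  proof (cases "x = 0")
    case False
    then have "N \<noteq> {}"
      by (auto simp: N_def intro!: exI[of _ "sgn x"] simp: norm_sgn)
    have "l \<le> Inf N"
    proof (rule ccontr)
      assume "\<not> l \<le> Inf N"
      then obtain R where R: "bounded_linear R" "\<And>z. Q (R z) - Inf N *\<^sub>R R z = z"
        using reg[of "Inf N"] by auto
      then obtain K where K: "0 < K" "\<And>z. norm (R z) \<le> norm z * K"
        using bounded_linear.pos_bounded by blast
      \<comment> \<open>This form is nonnegative by the choice of \<open>Inf N\<close>, and
        \<open>R\<close> represents all functionals in it. Coercivity then lifts the numerical range
        by \<open>1 / K\<close> above its own infimum.\<close>
      define s where "s u v = inner (Q u - Inf N *\<^sub>R u) v" for u v
      have "(norm z)\<^sup>2 / K \<le> s z z" for z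
      proof (rule nonneg_form_coercive[where V = UNIV and s = s and K = K])
        show "s (z - t *\<^sub>R x) (z - t *\<^sub>R x) = s z z - 2 * t * s x z + t\<^sup>2 * s x x" for z x t
          using sym[of z x]
          by (simp add: s_def Q.diff Q.scale algebra_simps power2_eq_square inner_commute)
        show "0 \<le> s (z - t *\<^sub>R x) (z - t *\<^sub>R x)" for z x t
          using Inf_le[of "z - t *\<^sub>R x"] by (simp only: s_def inner_diff_left inner_scaleR_left power2_norm_eq_inner)
        show "\<exists>x\<in>UNIV. norm x \<le> K * norm z \<and> (\<forall>w\<in>UNIV. s x w = inner z w)" for z
          using K(2)[of z] R(2)[of z] by (intro bexI[of _ "R z"]) (auto simp: s_def ac_simps)
      qed (use K in auto)
      then have "Inf N + 1 / K \<le> inner (Q x) x" if "norm x = 1" for x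
        using that \<open>\<And>z. (norm z)\<^sup>2 / K \<le> s z z\<close>[of x]
        by (simp add: s_def inner_diff_left power2_norm_eq_inner[symmetric])
      then have "Inf N + 1 / K \<le> Inf N"
        by (intro cInf_greatest[OF \<open>N \<noteq> {}\<close>]) (auto simp: N_def)
      then show False using K(1) by simp
    qed
    then have "l * (norm x)\<^sup>2 \<le> Inf N * (norm x)\<^sup>2"
      by (intro mult_right_mono) auto
    then show ?thesis
      using Inf_le[of x] by simp
  qed simp
qed

section \<open>Adjoints in terms of the real inner product\<close>

lemma scaleC_of_real [simp]: "complex_of_real r *\<^sub>C x = r *\<^sub>R x"
  by (simp add: scaleR_scaleC)

lemma bounded_selfadjointD:
  assumes "bounded_selfadjoint A"
  shows "bounded_linear A" and "inner (A x) y = inner x (A y)"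
  using assms by (simp_all add: bounded_selfadjoint_def inner_eq_Re_cinner)

text \<open>The imaginary part of \<open>cinner x y\<close> is minus the real part of \<open>cinner (\<i> *\<^sub>C x) y\<close>.\<close>

lemma adjoint_relation_iff:
  fixes B :: "('a::complex_hilbert_space, 'b::complex_hilbert_space) operator"
  assumes "linear_operator B"
  shows "(\<forall>x\<in>op_dom B. cinner (op_app B x) y = cinner x z) \<longleftrightarrow>
    (\<forall>x\<in>op_dom B. inner (op_app B x) y = inner x z)"
proof (intro iffI ballI)
  fix x assume real: "\<forall>x\<in>op_dom B. inner (op_app B x) y = inner x z" and x: "x \<in> op_dom B"
  have ix: "\<i> *\<^sub>C x \<in> op_dom B" "op_app B (\<i> *\<^sub>C x) = \<i> *\<^sub>C op_app B x"
    using assms x by (auto simp: linear_operator_def intro: complex_vector.subspace_scale)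
  have "Re (cinner (op_app B x) y) = Re (cinner x z)"
    using bspec[OF real x] by (simp add: inner_eq_Re_cinner)
  moreover have "Im (cinner (op_app B x) y) = Im (cinner x z)"
    using bspec[OF real ix(1)] by (simp add: ix(2) inner_eq_Re_cinner cinner_scaleC_left)
  ultimately show "cinner (op_app B x) y = cinner x z"
    by (simp add: complex_eq_iff)
qed (simp add: inner_eq_Re_cinner)

text \<open>Density makes the vector chosen by \<open>THE\<close> unique, so domain and value of the
  adjoint can be handled together as one relation in the real inner product.\<close>

lemma op_adjoint_iff:
  fixes B :: "('a::complex_hilbert_space, 'b::complex_hilbert_space) operator"
  assumes lin: "linear_operator B" and dense: "densely_defined B"
  shows "y \<in> op_dom (op_adjoint B) \<and> op_app (op_adjoint B) y = z \<longleftrightarrow>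
    (\<forall>x\<in>op_dom B. inner (op_app B x) y = inner x z)"
proof -
  have uniq: "z = z'" if "\<forall>x\<in>op_dom B. inner (op_app B x) y = inner x z"
    "\<forall>x\<in>op_dom B. inner (op_app B x) y = inner x z'" for z z'
    using that dense by (intro dense_inner_eqI[of "op_dom B"]) (auto simp: densely_defined_def)
  have dom: "y \<in> op_dom (op_adjoint B) \<longleftrightarrow> (\<exists>z. \<forall>x\<in>op_dom B. inner (op_app B x) y = inner x z)"
    by (simp add: op_adjoint_def adjoint_relation_iff[OF lin])
  have app: "op_app (op_adjoint B) y = z" if "\<forall>x\<in>op_dom B. inner (op_app B x) y = inner x z" for z
    unfolding op_adjoint_def operator.sel adjoint_relation_iff[OF lin]
    using that uniq by (intro the_equality) auto
  show ?thesis
    using dom app by blast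
qed

lemma op_adjoint_linear:
  fixes B :: "('a::complex_hilbert_space, 'b::complex_hilbert_space) operator"
  assumes "linear_operator B" and "densely_defined B"
    and "x \<in> op_dom (op_adjoint B)" and "y \<in> op_dom (op_adjoint B)"
  shows "x - t *\<^sub>R y \<in> op_dom (op_adjoint B)"
    and "op_app (op_adjoint B) (x - t *\<^sub>R y) = op_app (op_adjoint B) x - t *\<^sub>R op_app (op_adjoint B) y"
proof -
  have "\<forall>w\<in>op_dom B. inner (op_app B w) x = inner w (op_app (op_adjoint B) x)"
    and "\<forall>w\<in>op_dom B. inner (op_app B w) y = inner w (op_app (op_adjoint B) y)"
    using op_adjoint_iff[OF assms(1,2)] assms(3,4) by blast+
  then have "\<forall>w\<in>op_dom B. inner (op_app B w) (x - t *\<^sub>R y)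
      = inner w (op_app (op_adjoint B) x - t *\<^sub>R op_app (op_adjoint B) y)"
    by (simp add: inner_diff_right)
  then show "x - t *\<^sub>R y \<in> op_dom (op_adjoint B)"
    and "op_app (op_adjoint B) (x - t *\<^sub>R y) = op_app (op_adjoint B) x - t *\<^sub>R op_app (op_adjoint B) y"
    using op_adjoint_iff[OF assms(1,2)] by blast+
qed

lemma linear_operator_zero:
  assumes "linear_operator B"
  shows "0 \<in> op_dom B" and "op_app B 0 = 0"
proof -
  show 0: "0 \<in> op_dom B"
    using assms by (auto simp: linear_operator_def intro: complex_vector.subspace_0)
  have "op_app B (0 + 0) = op_app B 0 + op_app B 0"
    using assms 0 unfolding linear_operator_def by blast
  then show "op_app B 0 = 0"
    by simp
qed

text \<open>\<open>B\<^sup>*\<^sup>* \<subseteq> B\<close>: a vector orthogonal to the graph of \<open>B\<close> has the form \<open>(- B\<^sup>* q, q)\<close>.\<close>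

lemma closed_operator_biadjoint:
  fixes B :: "('a::complex_hilbert_space, 'b::complex_hilbert_space) operator"
  assumes lin: "linear_operator B" and "densely_defined B" and "closed_operator B"
    and v: "\<And>u. u \<in> op_dom (op_adjoint B) \<Longrightarrow> inner (op_app (op_adjoint B) u) v = inner u g"
  shows "v \<in> op_dom B \<and> op_app B v = g"
proof -
  let ?\<Gamma> = "{(x, op_app B x) | x. x \<in> op_dom B}"
  have "x + y \<in> op_dom B \<and> op_app B (x + y) = op_app B x + op_app B y"
    if "x \<in> op_dom B" "y \<in> op_dom B" for x y
    using lin that by (auto simp: linear_operator_def intro: complex_vector.subspace_add)
  moreover have "c *\<^sub>R x \<in> op_dom B \<and> op_app B (c *\<^sub>R x) = c *\<^sub>R op_app B x"
    if "x \<in> op_dom B" for c x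
    using lin that complex_vector.subspace_scale[of "op_dom B" x "complex_of_real c"]
    unfolding linear_operator_def scaleR_scaleC by blast
  ultimately have "subspace ?\<Gamma>"
    using linear_operator_zero[OF lin] by (force simp: subspace_def zero_prod_def)
  then have "(v, g) \<in> ?\<Gamma>"
  proof (rule in_closed_subspaceI[rotated])
    show "closed ?\<Gamma>"
      using \<open>closed_operator B\<close> by (simp add: closed_operator_def)
  next
    fix pq assume orth: "\<And>m. m \<in> ?\<Gamma> \<Longrightarrow> inner pq m = 0"
    obtain p q where pq: "pq = (p, q)" by fastforce
    have "inner p x + inner q (op_app B x) = 0" if "x \<in> op_dom B" for x
      using orth[of "(x, op_app B x)"] that by (auto simp: pq)
    then have "\<forall>x\<in>op_dom B. inner (op_app B x) q = inner x (- p)"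
      by (metis add.commute eq_neg_iff_add_eq_0 inner_commute inner_minus_right)
    then have "q \<in> op_dom (op_adjoint B)" "op_app (op_adjoint B) q = - p"
      using op_adjoint_iff[OF lin \<open>densely_defined B\<close>] by blast+
    then show "inner pq (v, g) = 0"
      using v[of q] by (simp add: pq)
  qed
  then show ?thesis by auto
qed

text \<open>Left to right is symmetry. Conversely, test vectors \<open>(0, y)\<close> give
  \<open>u\<close> in the domain of the adjoint of \<open>B\<close> by definition, and test vectors
  \<open>(x, 0)\<close> put \<open>v\<close> in the domain of the biadjoint, which closedness brings
  back to \<open>B\<close>.\<close>

lemma block_operator_selfadjoint:
  fixes A D :: "'a::complex_hilbert_space \<Rightarrow> 'a" and B :: "('a, 'a) operator"
  assumes B: "linear_operator B" "densely_defined B" "closed_operator B"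
    and A: "bounded_selfadjoint A" and D: "bounded_selfadjoint D"
  defines "T \<equiv> block_operator A B D"
  shows "p \<in> op_dom T \<and> op_app T p = r \<longleftrightarrow>
    (\<forall>q\<in>op_dom T. inner (op_app T q) p = inner q r)"
proof -
  let ?B' = "op_adjoint B"
  obtain u v where p: "p = (u, v)" by fastforce
  obtain f g where r: "r = (f, g)" by fastforce
  note sA = bounded_selfadjointD(2)[OF A] and sD = bounded_selfadjointD(2)[OF D]
  have A0: "A 0 = 0" and D0: "D 0 = 0"
    using bounded_selfadjointD(1)[OF A] bounded_selfadjointD(1)[OF D]
    by (auto simp: linear_simps)
  have adj: "inner (op_app B y) x = inner y (op_app ?B' x)" if "x \<in> op_dom ?B'" "y \<in> op_dom B" for x y
    using op_adjoint_iff[OF B(1,2)] that by blast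
  have "0 \<in> op_dom ?B' \<and> op_app ?B' 0 = 0"
    using op_adjoint_iff[OF B(1,2)] by simp
  then have B'0: "0 \<in> op_dom ?B'" "op_app ?B' 0 = 0" by auto
  note B0 = linear_operator_zero[OF B(1)]
  show ?thesis
  proof
    assume "p \<in> op_dom T \<and> op_app T p = r"
    then have "u \<in> op_dom ?B'" "v \<in> op_dom B" "f = A u + op_app B v" "g = op_app ?B' u + D v"
      by (auto simp: T_def block_operator_def p r)
    then show "\<forall>q\<in>op_dom T. inner (op_app T q) p = inner q r"
      using adj by (auto simp: T_def block_operator_def p r inner_add_left inner_add_right sA sD)
        (metis inner_commute)
  next
    assume *: "\<forall>q\<in>op_dom T. inner (op_app T q) p = inner q r"
    have rel: "inner (A x + op_app B y) u + inner (op_app ?B' x + D y) v = inner x f + inner y g"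
      if "x \<in> op_dom ?B'" "y \<in> op_dom B" for x y
      using bspec[OF *, of "(x, y)"] that by (simp add: T_def block_operator_def p r)
    have "\<forall>y\<in>op_dom B. inner (op_app B y) u = inner y (g - D v)"
      using rel[OF B'0(1)] by (simp add: A0 B'0 inner_diff_right inner_add_left sD eq_diff_eq)
    then have 1: "u \<in> op_dom ?B'" "op_app ?B' u = g - D v"
      using op_adjoint_iff[OF B(1,2)] by blast+
    have "inner (op_app ?B' x) v = inner x (f - A u)" if "x \<in> op_dom ?B'" for x
      using rel[OF that B0(1)] by (simp add: D0 B0 inner_diff_right inner_add_left sA eq_diff_eq add.commute)
    then have "v \<in> op_dom B \<and> op_app B v = f - A u"
      by (rule closed_operator_biadjoint[OF B])
    with 1 show "p \<in> op_dom T \<and> op_app T p = r"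
      by (simp add: T_def block_operator_def p r)
  qed
qed

text \<open>By selfadjointness a vector orthogonal to the range of \<open>T - l\<close> solves the
  eigenvalue equation, hence is 0. The Fredholm property makes the range closed, so it is
  everything; the inverse is symmetric and therefore bounded by Hellinger--Toeplitz.\<close>

lemma selfadjoint_bounded_inverse:
  fixes T :: "('a::complex_hilbert_space, 'a) operator"
  assumes sa: "\<And>p r. p \<in> op_dom T \<and> op_app T p = r \<longleftrightarrow>
      (\<forall>q\<in>op_dom T. inner (op_app T q) p = inner q r)"
    and fred: "fredholm (op_shift T (complex_of_real l))"
    and noev: "\<not> eigenvalue T (complex_of_real l)"
  obtains K where "0 < K"
    and "\<And>f. \<exists>p\<in>op_dom T. op_app T p - l *\<^sub>R p = f \<and> norm p \<le> K * norm f"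
proof -
  define S where "S p = op_app T p - l *\<^sub>R p" for p
  have symT: "inner (op_app T q) p = inner q (op_app T p)" if "p \<in> op_dom T" "q \<in> op_dom T" for p q
    using sa that by blast
  have symS: "inner (S q) p = inner q (S p)" if "p \<in> op_dom T" "q \<in> op_dom T" for p q
    using symT[OF that] by (simp add: S_def inner_diff_left inner_diff_right)
  \<comment> \<open>Linearity of \<open>T\<close> is read off from \<open>sa\<close>: sums and
    multiples satisfy the defining relation of the adjoint.\<close>
  have "0 \<in> op_dom T \<and> op_app T 0 = 0"
    by (subst sa) simp
  moreover have "p + q \<in> op_dom T \<and> op_app T (p + q) = op_app T p + op_app T q"
    if "p \<in> op_dom T" "q \<in> op_dom T" for p q
    using that symT by (subst sa) (simp add: inner_add_right)
  moreover have "c *\<^sub>R p \<in> op_dom T \<and> op_app T (c *\<^sub>R p) = c *\<^sub>R op_app T p" if "p \<in> op_dom T" for c p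
    using that symT by (subst sa) simp
  ultimately have T: "0 \<in> op_dom T" "S 0 = 0"
    "\<And>p q. p \<in> op_dom T \<Longrightarrow> q \<in> op_dom T \<Longrightarrow> p + q \<in> op_dom T \<and> S (p + q) = S p + S q"
    "\<And>c p. p \<in> op_dom T \<Longrightarrow> c *\<^sub>R p \<in> op_dom T \<and> S (c *\<^sub>R p) = c *\<^sub>R S p"
    by (auto simp: S_def algebra_simps)
  have sub: "subspace (S ` op_dom T)"
    unfolding subspace_def
  proof (intro conjI ballI allI)
    show "0 \<in> S ` op_dom T"
      using T(1,2) by force
  next
    fix f g assume "f \<in> S ` op_dom T" "g \<in> S ` op_dom T"
    then obtain p q where "p \<in> op_dom T" "q \<in> op_dom T" "f = S p" "g = S q" by blast
    then show "f + g \<in> S ` op_dom T"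
      using T(3)[of p q] by (intro image_eqI[of _ _ "p + q"]) auto
  next
    fix c f assume "f \<in> S ` op_dom T"
    then obtain p where "p \<in> op_dom T" "f = S p" by blast
    then show "c *\<^sub>R f \<in> S ` op_dom T"
      using T(4)[of p c] by (intro image_eqI[of _ _ "c *\<^sub>R p"]) auto
  qed
  have closed: "closed (S ` op_dom T)"
    using fred by (simp add: fredholm_def op_range_def op_shift_def S_def)
  have zero: "p = 0" if "\<And>f. f \<in> S ` op_dom T \<Longrightarrow> inner p f = 0" for p
  proof -
    have "inner p (S q) = 0" if "q \<in> op_dom T" for q
      using that \<open>\<And>f. f \<in> S ` op_dom T \<Longrightarrow> inner p f = 0\<close> by blast
    then have "\<forall>q\<in>op_dom T. inner (op_app T q) p = inner q (l *\<^sub>R p)"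
      by (simp add: S_def inner_diff_right inner_commute[of p])
    then have "p \<in> op_dom T" "op_app T p = l *\<^sub>R p"
      using sa by blast+
    then show "p = 0"
      using noev by (auto simp: eigenvalue_def)
  qed
  have surj: "f \<in> S ` op_dom T" for f
  proof (rule in_closed_subspaceI[OF closed sub])
    fix p assume "\<And>m. m \<in> S ` op_dom T \<Longrightarrow> inner p m = 0"
    then have "p = 0"
      by (rule zero)
    then show "inner p f = 0"
      by simp
  qed
  define R where "R = inv_into (op_dom T) S"
  have R: "R f \<in> op_dom T" "S (R f) = f" for f
    unfolding R_def using surj[of f] by (simp_all add: inv_into_into f_inv_into_f)
  have "inner (R x) y = inner x (R y)" for x y
    using symS[of "R y" "R x"] by (simp add: R)
  then obtain K where "0 < K" "\<And>f. norm (R f) \<le> K * norm f"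
    by (rule symmetric_imp_bounded) blast
  then show thesis
    using R by (intro that[of K]) (auto simp: S_def)
qed

section \<open>The Schur complement\<close>

lemma resolvent_everywhere:
  fixes D :: "'a::complex_hilbert_space \<Rightarrow> 'a"
  assumes "complex_of_real t \<notin> spectrum (everywhere D)"
  defines "R \<equiv> resolvent (everywhere D) (complex_of_real t)"
  shows "bounded_linear R" and "D (R z) - t *\<^sub>R R z = z"
proof -
  have *: "bij_betw (op_app (op_shift (everywhere D) (complex_of_real t))) UNIV UNIV"
    using assms(1) by (simp add: spectrum_def resolvent_set_def everywhere_def)
  show "bounded_linear R"
    using assms(1) by (simp add: R_def spectrum_def resolvent_set_def)
  have "op_app (op_shift (everywhere D) (complex_of_real t)) (R z) = z"
    unfolding R_def resolvent_def using bij_betw_inv_into_right[OF *] by (simp add: everywhere_def)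
  then show "D (R z) - t *\<^sub>R R z = z"
    by (simp add: op_shift_def everywhere_def)
qed

lemma is_min_spectrum_le:
  assumes A: "bounded_selfadjoint A" and a: "is_min_spectrum (everywhere A) a"
  shows "a * (norm x)\<^sup>2 \<le> inner (A x) x"
proof (rule numerical_range_lower_bound[OF bounded_selfadjointD[OF A]])
  fix t assume "t < a"
  then have "complex_of_real t \<notin> spectrum (everywhere A)"
    using a by (auto simp: is_min_spectrum_def)
  from resolvent_everywhere[OF this]
  show "\<exists>R. bounded_linear R \<and> (\<forall>z. A (R z) - t *\<^sub>R R z = z)" by blast
qed

text \<open>The lower bound is applied to \<open>- D\<close>, whose inverse at \<open>t\<close> is
  minus the resolvent of \<open>D\<close> at \<open>- t\<close>.\<close>

lemma is_max_spectrum_ge: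
  assumes D: "bounded_selfadjoint D" and d: "is_max_spectrum (everywhere D) d"
  shows "inner (D x) x \<le> d * (norm x)\<^sup>2"
proof -
  have "- d * (norm x)\<^sup>2 \<le> inner (- D x) x"
  proof (rule numerical_range_lower_bound)
    fix t assume "t < - d"
    then have "complex_of_real (- t) \<notin> spectrum (everywhere D)"
      using d unfolding is_max_spectrum_def by (meson less_minus_iff not_less)
    note R = resolvent_everywhere[OF this]
    let ?R = "resolvent (everywhere D) (complex_of_real (- t))"
    have "D (- ?R z) = - D (?R z)" for z
      using bounded_selfadjointD(1)[OF D] by (simp add: linear_simps)
    then show "\<exists>R. bounded_linear R \<and> (\<forall>z. - D (R z) - t *\<^sub>R R z = z)"
      using R by (intro exI[of _ "\<lambda>z. - ?R z"]) (simp add: bounded_linear_minus)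
  qed (use bounded_selfadjointD[OF D] in \<open>simp_all add: bounded_linear_minus\<close>)
  then show ?thesis by simp
qed

text \<open>Since \<open>inner ((\<mu> - D)\<^sup>-\<^sup>1 u) u\<close> is the supremum of \<open>2 * inner y u - inner ((\<mu> - D) y) y\<close> over \<open>y\<close>,
  the lower bound results from \<open>y = (\<kappa> - D)\<^sup>-\<^sup>1 u\<close>.\<close>

lemma resolvent_form_lower_bound:
  fixes D :: "'a::real_inner \<Rightarrow> 'a"
  assumes lin: "bounded_linear D" and sym: "\<And>x y. inner (D x) y = inner x (D y)"
    and D: "\<And>x. inner (D x) x \<le> d * (norm x)\<^sup>2"
    and "d < \<kappa>" and "\<kappa> \<le> \<mu>" and y: "\<kappa> *\<^sub>R y - D y = u" and w: "\<mu> *\<^sub>R w - D w = u"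
  shows "(1 - (\<mu> - \<kappa>) / (\<kappa> - d)) * inner y u \<le> inner w u"
proof -
  \<comment> \<open>The gap between \<open>d\<close> and \<kappa> turns an error in the squared norm
    of \<open>y\<close> into a multiple of \<open>inner y u\<close>; this produces the factor in the
    claim.\<close>
  have "(\<kappa> - d) * (norm y)\<^sup>2 \<le> inner y u"
    using D[of y] by (simp add: y[symmetric] inner_diff_right power2_norm_eq_inner inner_commute algebra_simps)
  then have bound: "(\<mu> - \<kappa>) * (norm y)\<^sup>2 \<le> (\<mu> - \<kappa>) * (inner y u / (\<kappa> - d))"
    using \<open>d < \<kappa>\<close> \<open>\<kappa> \<le> \<mu>\<close> by (intro mult_left_mono) (simp_all add: field_simps)
  \<comment> \<open>This is the amount by which the supremum, attained at \<open>w\<close>, exceeds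
    the value at \<open>y\<close>.\<close>
  have pos: "0 \<le> inner (\<mu> *\<^sub>R (w - y) - D (w - y)) (w - y)"
  proof -
    have "d * (norm (w - y))\<^sup>2 \<le> \<mu> * (norm (w - y))\<^sup>2"
      using assms(4,5) by (intro mult_right_mono) auto
    then show ?thesis
      using D[of "w - y"] by (simp add: inner_diff_left power2_norm_eq_inner)
  qed
  have diff: "\<mu> *\<^sub>R (w - y) - D (w - y) = (\<kappa> - \<mu>) *\<^sub>R y"
    using y w lin by (simp add: linear_simps algebra_simps)
  \<comment> \<open>The resolvent identity for \<kappa> and \<mu>, paired with
    \<open>u\<close>.\<close>
  have cross: "(\<mu> - \<kappa>) * inner y w = inner y u - inner w u"
  proof -
    have "inner y u = \<mu> * inner y w - inner y (D w)"
      unfolding w[symmetric] by (simp add: inner_diff_right)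
    moreover have "inner w u = \<kappa> * inner y w - inner (D y) w"
      unfolding inner_commute[of w] y[symmetric] by (simp add: inner_diff_left)
    ultimately show ?thesis
      by (simp add: sym left_diff_distrib)
  qed
  have "inner y u - inner w u \<le> (\<mu> - \<kappa>) * (norm y)\<^sup>2"
    using pos unfolding diff cross[symmetric]
    by (simp add: inner_diff_right power2_norm_eq_inner algebra_simps)
  also note bound
  also have "(\<mu> - \<kappa>) * (inner y u / (\<kappa> - d)) = (\<mu> - \<kappa>) / (\<kappa> - d) * inner y u"
    by simp
  finally show ?thesis
    by (simp add: left_diff_distrib[of 1])
qed

section \<open>Continuation in the spectral parameter\<close>

text \<open>Continuity of \<open>s\<close> in the parameter puts the supremum of the parameters with \<open>0 \<le> s\<close> into that
  set, and coercivity there lets one go further unless the supremum is \<open>\<nu>\<close>.\<close>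

lemma nonneg_forms_extend:
  fixes s :: "real \<Rightarrow> 'a::real_normed_vector \<Rightarrow> real"
  assumes "a \<le> \<nu>" and "0 < \<delta>" and "0 \<le> K"
    and base: "\<And>x. x \<in> V \<Longrightarrow> 0 \<le> s a x"
    and step: "\<And>\<kappa> \<mu> x. a \<le> \<kappa> \<Longrightarrow> \<kappa> \<le> \<mu> \<Longrightarrow> \<mu> \<le> \<nu> \<Longrightarrow> \<mu> \<le> \<kappa> + \<delta> \<Longrightarrow> x \<in> V \<Longrightarrow>
      (1 - (\<mu> - \<kappa>) / \<delta>) * s \<kappa> x - (\<mu> - \<kappa>) * K * (norm x)\<^sup>2 \<le> s \<mu> x"
    and coercive: "\<And>\<kappa>. a \<le> \<kappa> \<Longrightarrow> \<kappa> \<le> \<nu> \<Longrightarrow> (\<And>x. x \<in> V \<Longrightarrow> 0 \<le> s \<kappa> x) \<Longrightarrow>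
      \<exists>c>0. \<forall>x\<in>V. c * (norm x)\<^sup>2 \<le> s \<kappa> x"
  shows "\<exists>c>0. \<forall>x\<in>V. c * (norm x)\<^sup>2 \<le> s \<nu> x"
proof -
  define P where "P = {\<kappa>\<in>{a..\<nu>}. \<forall>x\<in>V. 0 \<le> s \<kappa> x}"
  define \<sigma> where "\<sigma> = Sup P"
  have "a \<in> P"
    using \<open>a \<le> \<nu>\<close> base by (simp add: P_def)
  have bdd: "bdd_above P"
    by (rule bdd_aboveI[of _ \<nu>]) (simp add: P_def)
  have \<sigma>: "a \<le> \<sigma>" "\<sigma> \<le> \<nu>"
    unfolding \<sigma>_def using \<open>a \<in> P\<close> bdd
    by (auto intro!: cSup_upper cSup_least simp: P_def)
  have nonneg: "0 \<le> s \<sigma> x" if "x \<in> V" for x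
  proof (rule field_le_epsilon)
    fix e :: real assume "0 < e"
    define b where "b = K * (norm x)\<^sup>2"
    have "0 \<le> b"
      using \<open>0 \<le> K\<close> by (simp add: b_def)
    \<comment> \<open>The first bound keeps the factor in \<open>step\<close> nonnegative, the
      second keeps the loss below \<open>e\<close>; \<open>b + 1\<close> is nonzero even when
      \<open>b = 0\<close>.\<close>
    define h where "h = min \<delta> (e / (b + 1))"
    have "0 < h"
      using \<open>0 < e\<close> \<open>0 \<le> b\<close> \<open>0 < \<delta>\<close> by (simp add: h_def)
    then obtain \<kappa> where \<kappa>: "\<kappa> \<in> P" "\<sigma> - h < \<kappa>"
      using less_cSupD[of P "\<sigma> - h"] \<open>a \<in> P\<close> by (auto simp: \<sigma>_def)
    have "\<kappa> \<le> \<sigma>"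
      unfolding \<sigma>_def using \<kappa>(1) bdd by (rule cSup_upper)
    have near: "\<sigma> - \<kappa> \<le> \<delta>" "\<sigma> - \<kappa> \<le> e / (b + 1)"
      using \<kappa>(2) by (simp_all add: h_def)
    have "0 \<le> (1 - (\<sigma> - \<kappa>) / \<delta>) * s \<kappa> x"
      using \<kappa>(1) that near(1) \<open>0 < \<delta>\<close> by (intro mult_nonneg_nonneg) (auto simp: P_def)
    then have "- ((\<sigma> - \<kappa>) * b) \<le> s \<sigma> x"
      using step[of \<kappa> \<sigma> x] \<kappa>(1) that near(1) \<open>\<kappa> \<le> \<sigma>\<close> \<sigma>(2) by (simp add: P_def b_def ac_simps)
    moreover have "(\<sigma> - \<kappa>) * b \<le> e"
    proof -
      have "(\<sigma> - \<kappa>) * b \<le> e / (b + 1) * (b + 1)"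
        using near(2) \<open>0 \<le> b\<close> \<open>0 < e\<close> by (intro mult_mono) auto
      then show ?thesis
        using \<open>0 \<le> b\<close> by simp
    qed
    ultimately show "0 \<le> s \<sigma> x + e" by simp
  qed
  then obtain c where c: "0 < c" "\<And>x. x \<in> V \<Longrightarrow> c * (norm x)\<^sup>2 \<le> s \<sigma> x"
    using coercive[OF \<sigma>] by blast
  have "\<sigma> = \<nu>"
  proof (rule ccontr)
    assume "\<sigma> \<noteq> \<nu>"
    \<comment> \<open>The three bounds keep \<sigma> + \<open>h\<close> in the interval, keep the
      factor in \<open>step\<close> at least 1/2, and keep the loss below half of the coercivity
      constant \<open>c\<close>.\<close>
    define h where "h = min (\<nu> - \<sigma>) (min (\<delta> / 2) (c / (2 * (K + 1))))"
    have "0 < h"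
      using \<open>\<sigma> \<noteq> \<nu>\<close> \<sigma> \<open>0 < \<delta>\<close> \<open>0 \<le> K\<close> c(1) by (simp add: h_def)
    have h: "h \<le> \<nu> - \<sigma>" "h \<le> \<delta> / 2" "h \<le> c / (2 * (K + 1))"
      unfolding h_def by (meson min.cobounded1 min.cobounded2 order_trans)+
    have "h * K \<le> c / 2"
    proof -
      have "h * K \<le> c / (2 * (K + 1)) * (K + 1)"
        using h(3) \<open>0 \<le> K\<close> c(1) by (intro mult_mono) auto
      also have "\<dots> = c / 2"
        using \<open>0 \<le> K\<close> by (simp add: divide_simps)
      finally show ?thesis .
    qed
    have "0 \<le> s (\<sigma> + h) x" if "x \<in> V" for x
    proof -
      have "h * K * (norm x)\<^sup>2 \<le> c / 2 * (norm x)\<^sup>2"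
        using \<open>h * K \<le> c / 2\<close> by (intro mult_right_mono) auto
      also have "\<dots> \<le> 1 / 2 * s \<sigma> x"
        using c(2)[OF that] by simp
      also have "\<dots> \<le> (1 - h / \<delta>) * s \<sigma> x"
        using h(2) \<open>0 < \<delta>\<close> nonneg[OF that] by (intro mult_right_mono) (auto simp: field_simps)
      finally show ?thesis
        using step[of \<sigma> "\<sigma> + h" x] \<sigma>(1) \<open>0 < h\<close> h \<open>0 < \<delta>\<close> that by simp
    qed
    then have "\<sigma> + h \<in> P"
      using \<sigma>(1) h(1) \<open>0 < h\<close> by (simp add: P_def)
    then have "\<sigma> + h \<le> \<sigma>"
      unfolding \<sigma>_def using bdd by (rule cSup_upper)
    then show False
      using \<open>0 < h\<close> by simp
  qed
  then show ?thesis
    using c by auto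
qed

theorem corollary3p5:
  fixes A D :: "'a::complex_hilbert_space \<Rightarrow> 'a"
    and B :: "('a, 'a) operator"
    and a d \<nu> :: real
    and x0 :: 'a
  assumes "linear_operator B" and "densely_defined B" and "closed_operator B"
    and "bounded_selfadjoint A" and "bounded_selfadjoint D"
    and "is_max_spectrum (everywhere D) d"
    and "is_min_spectrum (everywhere A) a"
    and "d < a"
    and "x0 \<in> op_dom (op_adjoint B)" and "x0 \<noteq> 0"
    and "a \<le> \<nu>" and "ereal \<nu> < lambda_e_plus (block_operator A B D) d"
    and "Re (schur_form A B D (complex_of_real \<nu>) x0 x0) \<le> 0"
  shows "\<exists>\<mu>::real. \<mu> \<in> {a..\<nu>} \<and> eigenvalue (block_operator A B D) (complex_of_real \<mu>)"
proof (rule ccontr)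
  assume noev: "\<nexists>\<mu>::real. \<mu> \<in> {a..\<nu>} \<and> eigenvalue (block_operator A B D) (complex_of_real \<mu>)"
  define T where "T = block_operator A B D"
  define V where "V = op_dom (op_adjoint B)"
  define C where "C = op_app (op_adjoint B)"
  \<comment> \<open>The sign is flipped so that \<open>G \<kappa>\<close> inverts \<kappa> -
    \<open>D\<close> and is positive for \<kappa> above \<open>d\<close>; \<open>s\<close> is then
    the real part of the Schur form.\<close>
  define G where "G \<kappa> u = - resolvent (everywhere D) (complex_of_real \<kappa>) u" for \<kappa> u
  define s where "s \<kappa> x y = inner (A x - \<kappa> *\<^sub>R x) y + inner (G \<kappa> (C x)) (C y)" for \<kappa> x y
  note A = bounded_selfadjointD[OF assms(4)] is_min_spectrum_le[OF assms(4,7)]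
  note D = bounded_selfadjointD[OF assms(5)] is_max_spectrum_ge[OF assms(5,6)]
  have V: "x - t *\<^sub>R y \<in> V" "C (x - t *\<^sub>R y) = C x - t *\<^sub>R C y" if "x \<in> V" "y \<in> V" for x y t
    using op_adjoint_linear[OF assms(1,2)] that by (auto simp: V_def C_def)
  have adj: "inner (op_app B y) x = inner y (C x)" if "x \<in> V" "y \<in> op_dom B" for x y
    using op_adjoint_iff[OF assms(1,2)] that by (auto simp: V_def C_def)

  have G: "bounded_linear (G \<kappa>)" "\<kappa> *\<^sub>R G \<kappa> u - D (G \<kappa> u) = u" if "a \<le> \<kappa>" for \<kappa> u
  proof -
    have "complex_of_real \<kappa> \<notin> spectrum (everywhere D)"
      using assms(6,8) that by (auto simp: is_max_spectrum_def)
    note R = resolvent_everywhere[OF this]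
    show "bounded_linear (G \<kappa>)"
      unfolding G_def using R(1) by (rule bounded_linear_minus)
    show "\<kappa> *\<^sub>R G \<kappa> u - D (G \<kappa> u) = u"
      using R(2)[of u] D(1) by (simp add: G_def linear_simps algebra_simps)
  qed
  have symG: "inner (G \<kappa> u) v = inner (G \<kappa> v) u" if "a \<le> \<kappa>" for \<kappa> u v
    using G(2)[OF that, of v] G(2)[OF that, of u] D(2)[of "G \<kappa> u" "G \<kappa> v"]
    by (smt (verit) inner_commute inner_diff_right inner_scaleR_right)
  have posG: "0 \<le> inner (G \<kappa> u) u" if "a \<le> \<kappa>" for \<kappa> u
  proof -
    have "0 \<le> (\<kappa> - d) * (norm (G \<kappa> u))\<^sup>2"
      using that \<open>d < a\<close> by simp
    also have "\<dots> \<le> inner (G \<kappa> u) (\<kappa> *\<^sub>R G \<kappa> u - D (G \<kappa> u))"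
      using D(3)[of "G \<kappa> u"]
      by (simp add: inner_diff_right power2_norm_eq_inner inner_commute algebra_simps)
    finally show ?thesis
      using G(2)[OF that] by simp
  qed

  have coercive: "\<exists>c>0. \<forall>x\<in>V. c * (norm x)\<^sup>2 \<le> s \<kappa> x x"
    if \<kappa>: "a \<le> \<kappa>" "\<kappa> \<le> \<nu>" and nonneg: "\<And>x. x \<in> V \<Longrightarrow> 0 \<le> s \<kappa> x x" for \<kappa>
  proof -
    have fred: "fredholm (op_shift T (complex_of_real \<kappa>))"
    proof (rule ccontr)
      assume "\<not> ?thesis"
      then have "lambda_e_plus T d \<le> ereal \<kappa>"
        unfolding lambda_e_plus_def using \<kappa> \<open>d < a\<close>
        by (intro INF_lower) (simp add: ess_spectrum_def)
      also have "\<dots> \<le> ereal \<nu>"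
        using \<kappa> by simp
      finally show False
        using assms(12) by (simp add: T_def)
    qed
    have "\<not> eigenvalue T (complex_of_real \<kappa>)"
      using noev \<kappa> by (auto simp: T_def)
    then obtain K where K: "0 < K"
      "\<And>f. \<exists>p\<in>op_dom T. op_app T p - \<kappa> *\<^sub>R p = f \<and> norm p \<le> K * norm f"
      using selfadjoint_bounded_inverse[OF _ fred] block_operator_selfadjoint[OF assms(1-5)]
      unfolding T_def by blast
    have "(norm x)\<^sup>2 / K \<le> s \<kappa> x x" if "x \<in> V" for x
    proof (rule nonneg_form_coercive[where s = "s \<kappa>" and V = V, OF K(1) _ _ _ that])
      fix x z t assume xz: "x \<in> V" "z \<in> V"
      show "0 \<le> s \<kappa> (z - t *\<^sub>R x) (z - t *\<^sub>R x)"
        using V xz nonneg by blast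
      have Ax: "inner (A z) x = inner (A x) z" "A (z - t *\<^sub>R x) = A z - t *\<^sub>R A x"
        using A(2)[of z x] A(1) by (simp_all add: inner_commute linear_simps)
      have Gx: "G \<kappa> (C z - t *\<^sub>R C x) = G \<kappa> (C z) - t *\<^sub>R G \<kappa> (C x)"
        using G(1)[OF \<kappa>(1)] by (simp add: linear_simps)
      show "s \<kappa> (z - t *\<^sub>R x) (z - t *\<^sub>R x) = s \<kappa> z z - 2 * t * s \<kappa> x z + t\<^sup>2 * s \<kappa> x x"
        unfolding s_def V(2)[OF xz(2,1)] Ax(2) Gx
        using symG[OF \<kappa>(1), of "C z" "C x"] Ax(1)
        by (simp add: inner_diff_left inner_diff_right power2_eq_square algebra_simps
            inner_commute[of z x])
    next
      \<comment> \<open>The solution \<open>(x, y)\<close> of \<open>(T - \<kappa>) (x, y) = (z, 0)\<close> has \<open>y = (\<kappa> - D)\<^sup>-\<^sup>1 B\<^sup>* x\<close>.\<close>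
      fix z
      obtain p where p: "p \<in> op_dom T" "op_app T p - \<kappa> *\<^sub>R p = (z, 0)" "norm p \<le> K * norm (z, 0::'a)"
        using K(2) by blast
      obtain x y where xy: "p = (x, y)" by fastforce
      have dom: "x \<in> V" "y \<in> op_dom B"
        using p(1) by (auto simp: T_def block_operator_def xy V_def)
      have eqs: "A x + op_app B y - \<kappa> *\<^sub>R x = z" "C x + D y - \<kappa> *\<^sub>R y = 0"
        using p(2) by (auto simp: T_def block_operator_def xy C_def)
      have "G \<kappa> (C x) = y"
      proof -
        \<comment> \<open>The second row puts this difference in the kernel of \<kappa> -
          \<open>D\<close>, which is trivial because \<open>D\<close> is bounded above by
          \<open>d\<close>, below \<kappa>.\<close>
        let ?w = "G \<kappa> (C x) - y"
        have "\<kappa> *\<^sub>R ?w - D ?w = 0"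
          using G(2)[OF \<kappa>(1), of "C x"] eqs(2) D(1) by (simp add: linear_simps algebra_simps)
        then have "\<kappa> * (norm ?w)\<^sup>2 = inner (D ?w) ?w"
          by (metis eq_iff_diff_eq_0 inner_scaleR_left power2_norm_eq_inner)
        then have "(\<kappa> - d) * (norm ?w)\<^sup>2 \<le> 0"
          using D(3)[of ?w] by (simp add: algebra_simps)
        then show ?thesis
          using \<kappa>(1) \<open>d < a\<close> by (simp add: mult_le_0_iff)
      qed
      \<comment> \<open>Moving \<open>B\<close> across the inner product turns
        \<open>inner (op_app B y) w\<close> into the resolvent term of the form, so the first row is
        the representation of \<open>inner z\<close>.\<close>
      then have "s \<kappa> x w = inner z w" if "w \<in> V" for w
        unfolding s_def eqs(1)[symmetric] using adj[OF that dom(2)]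
        by (simp add: inner_add_left inner_diff_left)
      moreover have "norm x \<le> K * norm z"
      proof -
        have "norm x \<le> norm p"
          unfolding xy by (rule norm_fst_le)
        also have "\<dots> \<le> K * norm z"
          using p(3) by (simp add: norm_Pair)
        finally show ?thesis .
      qed
      ultimately show "\<exists>x\<in>V. norm x \<le> K * norm z \<and> (\<forall>w\<in>V. s \<kappa> x w = inner z w)"
        using dom(1) by blast
    qed
    then show ?thesis
      using K(1) by (intro exI[of _ "1 / K"]) simp
  qed

  \<comment> \<open>The resolvent part keeps at least the fraction 1 - \<theta>. For
    \<open>A\<close> the fraction \<theta> is split off and bounded below by
    \<open>a - \<nu>\<close> times the squared norm, which gives the second summand of the constant;
    the shift from \<kappa> to \<mu> gives the 1.\<close>
  have step: "(1 - (\<mu> - \<kappa>) / (a - d)) * s \<kappa> x x - (\<mu> - \<kappa>) * (1 + (\<nu> - a) / (a - d)) * (norm x)\<^sup>2 \<le> s \<mu> x x"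
    if "a \<le> \<kappa>" "\<kappa> \<le> \<mu>" "\<mu> \<le> \<nu>" for \<kappa> \<mu> x
  proof -
    define g where "g \<kappa> = inner (G \<kappa> (C x)) (C x)" for \<kappa>
    define \<theta> where "\<theta> = (\<mu> - \<kappa>) / (a - d)"
    define n where "n = (norm x)\<^sup>2"
    have s: "s \<kappa> x x = inner (A x) x - \<kappa> * n + g \<kappa>" for \<kappa>
      by (simp add: s_def g_def n_def inner_diff_left power2_norm_eq_inner)
    have "0 \<le> \<theta>" "0 \<le> n"
      using that \<open>d < a\<close> by (simp_all add: \<theta>_def n_def)
    \<comment> \<open>Replacing \<kappa> - \<open>d\<close> by the smaller \<open>a - d\<close>
      makes the step length uniform in \<kappa>; positivity of \<open>g \<kappa>\<close> preserves
      the inequality.\<close>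
    have "(1 - \<theta>) * g \<kappa> \<le> (1 - (\<mu> - \<kappa>) / (\<kappa> - d)) * g \<kappa>"
    proof (rule mult_right_mono)
      show "1 - \<theta> \<le> 1 - (\<mu> - \<kappa>) / (\<kappa> - d)"
        unfolding \<theta>_def using that \<open>d < a\<close> by (intro diff_left_mono divide_left_mono) auto
    qed (simp add: g_def posG that)
    also have "\<dots> \<le> g \<mu>"
      unfolding g_def using that \<open>d < a\<close> G(2)
      by (intro resolvent_form_lower_bound[OF D]) auto
    finally have "(1 - \<theta>) * g \<kappa> \<le> g \<mu>" .
    moreover have "\<theta> * ((a - \<nu>) * n) \<le> \<theta> * (inner (A x) x - \<kappa> * n)"
    proof (rule mult_left_mono[OF _ \<open>0 \<le> \<theta>\<close>])
      have "\<kappa> * n \<le> \<nu> * n"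
        using that \<open>0 \<le> n\<close> by (intro mult_right_mono) auto
      then show "(a - \<nu>) * n \<le> inner (A x) x - \<kappa> * n"
        using A(3)[of x] by (simp add: n_def algebra_simps)
    qed
    moreover have "(\<mu> - \<kappa>) * (1 + (\<nu> - a) / (a - d)) * n = (\<mu> - \<kappa>) * n + \<theta> * ((\<nu> - a) * n)"
      by (simp add: \<theta>_def algebra_simps diff_divide_distrib)
    ultimately show ?thesis
      unfolding s \<theta>_def[symmetric] n_def[symmetric] by (simp add: algebra_simps)
  qed

  have "\<exists>c>0. \<forall>x\<in>V. c * (norm x)\<^sup>2 \<le> s \<nu> x x"
  proof (rule nonneg_forms_extend[where s = "\<lambda>\<kappa> x. s \<kappa> x x" and \<delta> = "a - d" and a = a
        and K = "1 + (\<nu> - a) / (a - d)"])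
    \<comment> \<open>At the left endpoint both summands are nonnegative: \<open>A\<close> is
      bounded below by \<open>a\<close>, and \<open>G a\<close> is positive.\<close>
    show "0 \<le> s a x x" for x
      using A(3)[of x] posG[of a "C x"] by (simp add: s_def inner_diff_left power2_norm_eq_inner)
  qed (use \<open>a \<le> \<nu>\<close> \<open>d < a\<close> step coercive in auto)
  then have "0 < s \<nu> x0 x0"
    using assms(9,10) unfolding V_def by (smt (verit) mult_pos_pos zero_less_norm_iff zero_less_power)
  moreover have "Re (schur_form A B D (complex_of_real \<nu>) x0 x0) = s \<nu> x0 x0"
    by (simp add: schur_form_def s_def G_def C_def flip: inner_eq_Re_cinner)
  ultimately show False
    using assms(13) by simp
qed

end
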